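(* Let $a_0=0$ and let $(a_n)_{n\ge 1}$ be the increasing sequence of positive integers whose odd part is of the form $4k+1$. Then $(a_n)_{n\ge 0}$ is not $q$-regular for any integer $q\ge 2$.
   Context: The odd part of a positive integer $m$ is $m/2^v$ with $2^v$ the largest power of $2$ dividing $m$. The $q$-kernel of an integer sequence $(x_n)_{n\ge 0}$ is the set of subsequences $\{(x_{q^in+j})_{n\ge 0} : i\ge 0,\ 0\le j\le q^i-1\}$. The sequence is $q$-regular if the $\mathbb{Z}$-module generated by its $q$-kernel is finitely generated. *)

theory Defs
  imports
    "HOL-Computational_Algebra.Computational_Algebra"
    "HOL-Library.Infinite_Set"
    "HOL-Library.Function_Algebras"
begin

definition odd_part :: "nat \<Rightarrow> nat" where
  "odd_part m = m div 2 ^ multiplicity 2 m"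

definition q_kernel :: "nat \<Rightarrow> (nat \<Rightarrow> int) \<Rightarrow> (nat \<Rightarrow> int) set" where
  "q_kernel q x = {(\<lambda>n. x (q ^ i * n + j)) | i j. j \<le> q ^ i - 1}"

text \<open>Integer sequences as a module over the integers, with pointwise operations
  (addition comes from Function_Algebras).\<close>

definition seq_scale :: "int \<Rightarrow> (nat \<Rightarrow> int) \<Rightarrow> nat \<Rightarrow> int" where
  "seq_scale c f = (\<lambda>n. c * f n)"

interpretation int_seq: module seq_scale
  by unfold_locales (auto simp: seq_scale_def fun_eq_iff algebra_simps)

definition q_regular :: "nat \<Rightarrow> (nat \<Rightarrow> int) \<Rightarrow> bool" where
  "q_regular q x \<longleftrightarrow>
     (\<exists>B. finite B \<and> int_seq.span B = int_seq.span (q_kernel q x))"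

definition odd_part_1_mod_4 :: "nat set" where
  "odd_part_1_mod_4 = {m. m > 0 \<and> (\<exists>k. odd_part m = 4 * k + 1)}"

definition a_seq :: "nat \<Rightarrow> nat" where
  "a_seq n = (if n = 0 then 0 else enumerate odd_part_1_mod_4 (n - 1))"

text \<open>Since \<^const>\<open>enumerate\<close> lists a set in increasing order only if that set is infinite,
  the next facts confirm that \<^const>\<open>a_seq\<close> is the intended sequence.\<close>

lemma infinite_odd_part_1_mod_4: "infinite odd_part_1_mod_4"
proof -
  have "4 * k + 1 \<in> odd_part_1_mod_4" for k :: nat
  proof -
    have "multiplicity 2 (4 * k + 1) = 0"
      by (rule not_dvd_imp_multiplicity_0) presburger
    then show ?thesis
      by (simp add: odd_part_1_mod_4_def odd_part_def)
  qed
  then have "range (\<lambda>k::nat. 4 * k + 1) \<subseteq> odd_part_1_mod_4"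
    by blast
  moreover have "infinite (range (\<lambda>k::nat. 4 * k + 1))"
    by (rule range_inj_infinite) (simp add: inj_def)
  ultimately show ?thesis
    using finite_subset by blast
qed

lemma strict_mono_on_a_seq: "strict_mono_on {1..} a_seq"
  by (rule strict_mono_onI)
    (auto simp: a_seq_def intro!: enumerate_mono infinite_odd_part_1_mod_4)

lemma image_a_seq: "a_seq ` {1..} = odd_part_1_mod_4"
proof -
  have "a_seq ` {1..} = range (\<lambda>n. a_seq (Suc n))"
  proof -
    have "{1::nat..} = range Suc"
      by (metis One_nat_def atLeast_Suc_greaterThan greaterThan_0)
    then show ?thesis
      by (simp add: image_image)
  qed
  also have "\<dots> = range (enumerate odd_part_1_mod_4)"
    by (simp add: a_seq_def)
  also have "\<dots> = odd_part_1_mod_4"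
    by (rule range_enumerate) (rule infinite_odd_part_1_mod_4)
  finally show ?thesis .
qed

end

theory Submission
  imports Defs "HOL-Number_Theory.Residues"
begin

text \<open>
  Let \<open>pf m\<close> be \<open>1\<close> or \<open>-1\<close> according to whether the odd part of \<open>m\<close> is \<open>1\<close> or \<open>3\<close> modulo
  \<open>4\<close> (the regular paperfolding sequence), with partial sums \<open>pf_sum\<close>. The \<open>N\<close>-th term is the
  \<open>z\<close> with \<open>pf z = 1\<close> and \<open>z + pf_sum z = 2 * N\<close>. Since \<open>pf (2 ^ (L + 1) * M - m) = - pf m\<close>
  for \<open>0 < m < 2 ^ L\<close>, the gap after the term of index \<open>2 ^ L * M\<close> is a gap between two
  consecutive positions where \<open>pf = -1\<close>, and which gap it is depends only on \<open>pf_sum (2 * M - 1)\<close>,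
  as long as this number is small compared to \<open>2 ^ L\<close>.

  If the sequence were \<open>q\<close>-regular, the gap sequences \<open>a(q ^ i * n + 1) - a(q ^ i * n)\<close> would be
  bounded elements of one finitely generated module. There are only finitely many of those, so
  the gap sequences for some \<open>i < j\<close> coincide. If \<open>q\<close> is a power of two, \<open>q ^ i = 2 ^ I\<close>, this
  fails for an odd \<open>n\<close> for which \<open>pf_sum (2 * n - 1)\<close> is so large that the gap reaches distance
  \<open>2 ^ I\<close> from \<open>2 ^ (I + 1) * n\<close>, where the reflection rule breaks down for \<open>i\<close> but not for \<open>j\<close>.
  If \<open>q\<close> has an odd part \<open>p > 1\<close>, take for \<open>n\<close> a large power of two times
  \<open>(2 ^ (K * s) - 1) div p ^ j\<close>. The odd part of \<open>q ^ j * n\<close> is then \<open>2 ^ (K * s) - 1\<close>, which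
  pins the gap for \<open>j\<close>, whereas the odd part of \<open>q ^ i * n\<close> consists of \<open>s\<close> copies of one
  binary block, so that the gap for \<open>i\<close> runs through an arithmetic progression as \<open>s\<close> varies.
\<close>

section \<open>Paperfolding signs and their partial sums\<close>

definition pf :: "nat \<Rightarrow> int" where
  "pf m = (if m = 0 then 0 else if m \<in> odd_part_1_mod_4 then 1 else -1)"

definition pf_sum :: "nat \<Rightarrow> int" where
  "pf_sum n = sum pf {..n}"

lemma pf_0 [simp]: "pf 0 = 0"
  by (simp add: pf_def)

lemma pf_sum_0 [simp]: "pf_sum 0 = 0"
  by (simp add: pf_sum_def)

lemma pf_sum_Suc: "pf_sum (Suc n) = pf_sum n + pf (Suc n)"
  by (simp add: pf_sum_def)

lemma odd_part_odd: "odd m \<Longrightarrow> odd_part m = m"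
  by (simp add: odd_part_def not_dvd_imp_multiplicity_0)

lemma odd_part_double: "m > 0 \<Longrightarrow> odd_part (2 * m) = odd_part m"
  by (simp add: odd_part_def multiplicity_times_same)

lemma pf_double [simp]: "pf (2 * m) = pf m"
  by (cases "m = 0") (simp_all add: pf_def odd_part_1_mod_4_def odd_part_double)

lemma pf_4k1: "n mod 4 = 1 \<Longrightarrow> pf n = 1"
proof -
  assume n: "n mod 4 = 1"
  then have "n = 4 * (n div 4) + 1" "odd n" "n > 0" by presburger+
  then show ?thesis
    using odd_part_odd[of n] by (auto simp: pf_def odd_part_1_mod_4_def)
qed

lemma pf_4k3: "n mod 4 = 3 \<Longrightarrow> pf n = -1"
proof -
  assume n: "n mod 4 = 3"
  then have "\<And>k. n \<noteq> 4 * k + 1" "odd n" "n > 0" by presburger+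
  then show ?thesis
    using odd_part_odd[of n] by (auto simp: pf_def odd_part_1_mod_4_def)
qed

lemma odd_mod_4_cases:
  fixes n :: nat
  assumes "odd n"
  obtains "n mod 4 = 1" | "n mod 4 = 3"
proof -
  from assms have "n mod 4 = 1 \<or> n mod 4 = 3" by presburger
  then show ?thesis using that by blast
qed

lemma pf_power_2_times [simp]: "pf (2 ^ k * m) = pf m"
  by (induction k) (simp_all add: mult.assoc)

lemma pf_cases: "m > 0 \<Longrightarrow> pf m = 1 \<or> pf m = -1"
  by (simp add: pf_def)

text \<open>As \<open>m < 2 ^ L\<close>, the power of two in \<open>m\<close> is at most
  \<open>2 ^ (L - 1)\<close>; dividing it out leaves the shift a multiple of
  \<open>4\<close>.\<close>

lemma pf_shift:
  assumes "0 < m" "m < 2 ^ L"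
  shows "pf (2 ^ (L + 1) * M + m) = pf m"
  using assms
proof (induction L arbitrary: m)
  case 0
  then show ?case by simp
next
  case (Suc L)
  show ?case
  proof (cases "even m")
    case True
    then obtain k where k: "m = 2 * k" by blast
    have "2 ^ (Suc L + 1) * M + m = 2 * (2 ^ (L + 1) * M + k)" by (simp add: k)
    then have "pf (2 ^ (Suc L + 1) * M + m) = pf (2 ^ (L + 1) * M + k)"
      by (metis pf_double)
    also have "\<dots> = pf k" using Suc.IH[of k] Suc.prems k by simp
    finally show ?thesis by (simp add: k)
  next
    case False
    have *: "(2 ^ (Suc L + 1) * M + m) mod 4 = m mod 4"
    proof -
      have "2 ^ (Suc L + 1) * M + m = m + 4 * (2 ^ L * M)" by simp
      then show ?thesis by (metis mod_mult_self2)
    qed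
    from False show ?thesis
      by (cases rule: odd_mod_4_cases) (metis * pf_4k1 pf_4k3)+
  qed
qed

text \<open>Here \<open>z\<close> and \<open>m\<close> contain the same power of two and their odd
  parts sum to a multiple of \<open>4\<close>.\<close>

lemma pf_reflect:
  assumes "0 < m" "m < 2 ^ L" "z + m = 2 ^ (L + 1) * M"
  shows "pf z = - pf m"
  using assms
proof (induction L arbitrary: m z)
  case 0
  then show ?case by simp
next
  case (Suc L)
  have dvd: "z + m = 4 * (2 ^ L * M)" using Suc.prems by simp
  show ?case
  proof (cases "even m")
    case True
    with dvd have "even z" by presburger
    with True obtain k y where k: "m = 2 * k" and y: "z = 2 * y" by blast
    have "pf y = - pf k" using Suc.IH[of k y] Suc.prems k y by simp
    then show ?thesis by (simp add: k y)
  next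
    case False
    then show ?thesis
    proof (cases rule: odd_mod_4_cases)
      case 1
      with dvd have "z mod 4 = 3" by presburger
      with 1 show ?thesis by (simp add: pf_4k1 pf_4k3)
    next
      case 2
      with dvd have "z mod 4 = 1" by presburger
      with 2 show ?thesis by (simp add: pf_4k1 pf_4k3)
    qed
  qed
qed

text \<open>Even positions reproduce \<open>pf_sum x\<close>; odd positions contribute
  \<open>1, -1, 1, ...\<close> alternately.\<close>

lemma pf_sum_double: "pf_sum (2 * x) = pf_sum x + of_bool (odd x)"
proof (induction x)
  case (Suc x)
  have "pf_sum (2 * Suc x) = pf_sum (2 * x) + pf (2 * x + 1) + pf (2 * Suc x)"
    by (simp add: pf_sum_Suc)
  moreover have "pf (2 * x + 1) = (if even x then 1 else -1)"
  proof (cases "even x")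
    case True
    then have "(2 * x + 1) mod 4 = 1" by presburger
    with True show ?thesis by (simp only: pf_4k1 if_True)
  next
    case False
    then have "(2 * x + 1) mod 4 = 3" by presburger
    with False show ?thesis by (simp only: pf_4k3 if_False)
  qed
  ultimately show ?case
    using Suc.IH by (simp add: pf_sum_Suc del: mult_Suc_right)
qed simp

lemma pf_sum_double_plus_1: "pf_sum (2 * x + 1) = pf_sum x + of_bool (even x)"
proof -
  have "pf_sum (2 * Suc x) = pf_sum (2 * x + 1) + pf (2 * Suc x)"
    by (simp add: pf_sum_Suc)
  then show ?thesis
    using pf_sum_double[of "Suc x"] by (simp add: pf_sum_Suc del: mult_Suc_right)
qed

lemma even_pf_sum_iff: "even (pf_sum x) \<longleftrightarrow> even x"
proof (induction x)
  case (Suc x)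
  then show ?case using pf_cases[of "Suc x"] by (auto simp: pf_sum_Suc)
qed simp

lemma pf_sum_pos: "x > 0 \<Longrightarrow> pf_sum x > 0"
proof (induction x rule: less_induct)
  case (less x)
  show ?case
  proof (cases "x = 1")
    case True
    then show ?thesis using pf_sum_double_plus_1[of 0] by simp
  next
    case False
    with less.prems have "x div 2 > 0" "x div 2 < x" by auto
    then have "pf_sum (x div 2) > 0" by (intro less.IH)
    then have "pf_sum (2 * (x div 2)) > 0" "pf_sum (2 * (x div 2) + 1) > 0"
      unfolding pf_sum_double pf_sum_double_plus_1 by simp_all
    moreover have "x = 2 * (x div 2) \<or> x = 2 * (x div 2) + 1" by presburger
    ultimately show ?thesis by metis
  qed
qed

lemma pf_sum_power_2_times [simp]: "pf_sum (2 ^ Suc k * M) = pf_sum (2 * M)"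
proof (induction k)
  case (Suc k)
  have "pf_sum (2 ^ Suc (Suc k) * M) = pf_sum (2 * (2 ^ Suc k * M))"
    by (simp add: mult.assoc)
  also have "\<dots> = pf_sum (2 ^ Suc k * M)" by (subst pf_sum_double) simp
  finally show ?case using Suc.IH by simp
qed simp

lemma pf_sum_shift:
  assumes "m < 2 ^ L"
  shows "pf_sum (2 ^ (L + 1) * M + m) = pf_sum (2 * M) + pf_sum m"
  using assms
proof (induction m)
  case 0
  then show ?case using pf_sum_power_2_times[of L M] by simp
next
  case (Suc m)
  then show ?case using pf_shift[of "Suc m" L M] by (simp add: pf_sum_Suc)
qed

text \<open>Going down from \<open>2 ^ (L + 1) * M - 1\<close> to \<open>z\<close> passes the mirror
  images of \<open>1, ..., m - 1\<close>, hence the correction \<open>- pf m\<close>.\<close>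

lemma pf_sum_reflect:
  assumes "0 < m" "m < 2 ^ L" "z + m = 2 ^ (L + 1) * M"
  shows "pf_sum z = pf_sum (2 * M - 1) + pf_sum m - pf m"
  using assms
proof (induction m arbitrary: z)
  case 0
  then show ?case by simp
next
  case (Suc m)
  show ?case
  proof (cases "m = 0")
    case True
    with Suc.prems have z: "Suc z = 2 ^ Suc L * M" by simp
    then have "M > 0" by (cases M) auto
    then have M: "2 * M = Suc (2 * M - 1)" by simp
    have "pf_sum z + pf (Suc z) = pf_sum (2 * M - 1) + pf (2 * M)"
      using pf_sum_Suc[of z] pf_sum_Suc[of "2 * M - 1"] pf_sum_power_2_times[of L M] z M by simp
    moreover have "pf (Suc z) = pf (2 * M)" unfolding z pf_power_2_times pf_double ..
    ultimately show ?thesis using True by (simp add: pf_sum_Suc)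
  next
    case False
    then have "pf_sum (Suc z) = pf_sum (2 * M - 1) + pf_sum m - pf m"
      using Suc.prems by (intro Suc.IH) auto
    moreover have "pf (Suc z) = - pf m"
      using False Suc.prems by (intro pf_reflect[of m L "Suc z" M]) auto
    ultimately show ?thesis by (simp add: pf_sum_Suc)
  qed
qed

lemma pf_sum_pred_power_2: "A > 0 \<Longrightarrow> pf_sum (2 ^ A - 1) = 1"
proof (induction A)
  case (Suc A)
  show ?case
  proof (cases "A = 0")
    case True
    then show ?thesis using pf_sum_double_plus_1[of 0] by simp
  next
    case False
    have "2 * x - 1 = 2 * (x - 1) + 1" if "1 \<le> x" for x :: nat using that by simp
    then have "pf_sum (2 ^ Suc A - 1) = pf_sum (2 * (2 ^ A - 1) + 1)" by simp
    also have "\<dots> = pf_sum (2 ^ A - 1)" using False by (subst pf_sum_double_plus_1) simp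
    finally show ?thesis using Suc.IH False by simp
  qed
qed simp

lemma pf_sum_double_pred_power_2: "A > 0 \<Longrightarrow> pf_sum (2 * (2 ^ A - 1)) = 2"
  by (subst pf_sum_double) (simp add: pf_sum_pred_power_2 del: One_nat_def)

lemma pf_pred_power_2:
  assumes "A \<ge> 2"
  shows "pf (2 ^ A - 1) = -1"
proof (rule pf_4k3)
  from assms obtain B where "A = B + 2" by (metis add.commute le_iff_add)
  then have "(2::nat) ^ A = 4 * 2 ^ B" by simp
  moreover obtain c where "(2::nat) ^ B = Suc c" using not0_implies_Suc[of "2 ^ B"] by auto
  ultimately have "(2::nat) ^ A - 1 = 3 + 4 * c" by simp
  then show "((2::nat) ^ A - 1) mod 4 = 3" by simp
qed

lemma pf_small: "pf 3 = -1" "pf 6 = -1" "pf 7 = -1"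
  using pf_4k3[of 3] pf_4k3[of 7] pf_double[of 3] by simp_all

lemma pf_sum_small: "pf_sum 3 = 1" "pf_sum 6 = 2" "pf_sum 7 = 1"
  using pf_sum_pred_power_2[of 2] pf_sum_double_pred_power_2[of 2] pf_sum_pred_power_2[of 3]
  by simp_all

lemma ex_pf_sum_eq: "\<exists>x. x mod 4 = 1 \<and> pf_sum x = 2 * int j + 1"
proof (induction j)
  case 0
  then show ?case using pf_sum_double_plus_1[of 0] by (intro exI[of _ 1]) simp
next
  case (Suc j)
  then obtain x where x: "x mod 4 = 1" "pf_sum x = 2 * int j + 1" by blast
  from x(1) have "odd x" by presburger
  \<comment> \<open>Appending the binary digits \<open>01\<close> keeps the residue and raises the
    sum by \<open>2\<close>.\<close>
  then have "pf_sum (2 * (2 * x) + 1) = pf_sum x + 2"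
    unfolding pf_sum_double_plus_1 pf_sum_double[of x] by simp
  moreover have "(2 * (2 * x) + 1) mod 4 = 1" by presburger
  ultimately show ?case using x(2) by (intro exI[of _ "2 * (2 * x) + 1"]) simp
qed

section \<open>The sequence and its counting function\<close>

lemma pf_sum_eq_card: "int x + pf_sum x = 2 * int (card (odd_part_1_mod_4 \<inter> {..x}))"
proof (induction x)
  case 0
  have "odd_part_1_mod_4 \<inter> {..0} = {}" by (auto simp: odd_part_1_mod_4_def)
  then show ?case by simp
next
  case (Suc x)
  have "odd_part_1_mod_4 \<inter> {..Suc x} =
    (if Suc x \<in> odd_part_1_mod_4 then insert (Suc x) (odd_part_1_mod_4 \<inter> {..x})
     else odd_part_1_mod_4 \<inter> {..x})"
    by (auto simp: le_Suc_eq)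
  then show ?case using Suc.IH by (simp add: pf_sum_Suc pf_def)
qed

lemma a_seq_mem: "n \<ge> 1 \<Longrightarrow> a_seq n \<in> odd_part_1_mod_4"
  using image_a_seq by blast

lemma pf_a_seq: "n \<ge> 1 \<Longrightarrow> pf (a_seq n) = 1"
  using a_seq_mem[of n] by (auto simp: pf_def odd_part_1_mod_4_def)

lemma card_atMost_a_seq:
  assumes "k \<ge> 1"
  shows "card (odd_part_1_mod_4 \<inter> {..a_seq k}) = k"
proof -
  have "odd_part_1_mod_4 \<inter> {..a_seq k} = a_seq ` {1..k}"
    using assms
    by (auto simp: image_a_seq[symmetric] strict_mono_on_leD[OF strict_mono_on_a_seq]
        strict_mono_on_less_eq[OF strict_mono_on_a_seq])
  moreover have "inj_on a_seq {1..k}"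
    by (rule inj_on_subset[OF strict_mono_on_imp_inj_on[OF strict_mono_on_a_seq]]) auto
  ultimately show ?thesis by (simp add: card_image)
qed

lemma a_seq_eqI:
  assumes "pf z = 1" "int z + pf_sum z = 2 * int N"
  shows "a_seq N = z"
proof -
  have "z \<in> odd_part_1_mod_4" using assms(1) by (auto simp: pf_def split: if_splits)
  then obtain k where k: "k \<ge> 1" "z = a_seq k" using image_a_seq by blast
  then show ?thesis
    using assms(2) pf_sum_eq_card[of z] card_atMost_a_seq[of k] by simp
qed

text \<open>The number \<open>int t - pf_sum t\<close> is twice the count of positions up to
  \<open>t\<close> with \<open>pf = -1\<close>, so raising \<open>N\<close> by one moves
  \<open>t\<close> down to the previous such position.\<close>

lemma a_seq_reflect:
  assumes "pf t = -1" "t < 2 ^ L" "z + t = 2 ^ (L + 1) * M"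
    and "2 * int N = 2 ^ (L + 1) * int M + pf_sum (2 * M - 1) + 1 - (int t - pf_sum t)"
  shows "a_seq N = z"
proof (rule a_seq_eqI)
  have t: "t > 0" using assms(1) by (cases t) auto
  show "pf z = 1" using pf_reflect[OF t assms(2,3)] assms(1) by simp
  have "int z + int t = 2 ^ (L + 1) * int M"
    using assms(3) by (metis of_nat_add of_nat_mult of_nat_numeral of_nat_power)
  then show "int z + pf_sum z = 2 * int N"
    using pf_sum_reflect[OF t assms(2,3)] assms(1,4) by simp
qed

lemma a_seq_less_Suc: "a_seq n < a_seq (Suc n)"
proof (cases "n = 0")
  case True
  then show ?thesis using a_seq_mem[of 1] by (auto simp: a_seq_def odd_part_1_mod_4_def)
next
  case False
  then show ?thesis by (intro strict_mono_onD[OF strict_mono_on_a_seq]) auto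
qed

lemma a_seq_Suc_le: "a_seq (Suc n) \<le> a_seq n + 4"
proof (rule ccontr)
  assume *: "\<not> ?thesis"
  have "\<exists>x. x mod 4 = 1 \<and> a_seq n < x \<and> x \<le> a_seq n + 4" by presburger
  then obtain x where x: "x mod 4 = 1" "a_seq n < x" "x \<le> a_seq n + 4" by blast
  then have "x \<in> odd_part_1_mod_4" using pf_4k1[of x] by (auto simp: pf_def split: if_splits)
  then obtain k where k: "k \<ge> 1" "x = a_seq k" using image_a_seq by blast
  have "k < Suc n"
    using strict_mono_on_less[OF strict_mono_on_a_seq, of k "Suc n"] * x k by auto
  moreover have "n < k"
    using strict_mono_on_less[OF strict_mono_on_a_seq, of n k] x k by (cases "n = 0") auto
  ultimately show False by simp
qed

section \<open>Bounded sequences in finitely generated modules\<close>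

text \<open>
  When a generator \<open>b\<close> is added, one more point \<open>n0\<close> suffices: cross-multiplying two elements
  that vanish on the old points cancels \<open>b\<close>, so these elements are all proportional.
\<close>

lemma finite_separating_set:
  assumes "finite B"
  shows "\<exists>F. finite F \<and> (\<forall>g\<in>int_seq.span B. (\<forall>n\<in>F. g n = 0) \<longrightarrow> g = 0)"
  using assms
proof (induction B)
  case empty
  then show ?case by (intro exI[of _ "{}"]) simp
next
  case (insert b B)
  then obtain F where F: "finite F"
    "\<And>g. g \<in> int_seq.span B \<Longrightarrow> (\<forall>n\<in>F. g n = 0) \<Longrightarrow> g = 0" by blast
  show ?case
  proof (cases "\<forall>h\<in>int_seq.span (insert b B). (\<forall>n\<in>F. h n = 0) \<longrightarrow> h = 0")
    case True
    with F(1) show ?thesis by blast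
  next
    case False
    then obtain h0 n0 where h0: "h0 \<in> int_seq.span (insert b B)" "\<forall>n\<in>F. h0 n = 0"
      "h0 n0 \<noteq> 0" by (auto simp: fun_eq_iff)
    from h0(1) obtain k0 where k0: "h0 - seq_scale k0 b \<in> int_seq.span B"
      by (auto simp: int_seq.span_insert)
    have "h = 0" if h: "h \<in> int_seq.span (insert b B)" "\<forall>n\<in>insert n0 F. h n = 0" for h
    proof -
      from h(1) obtain k where k: "h - seq_scale k b \<in> int_seq.span B"
        by (auto simp: int_seq.span_insert)
      have "seq_scale k0 h - seq_scale k h0 =
          seq_scale k0 (h - seq_scale k b) - seq_scale k (h0 - seq_scale k0 b)"
        by (simp add: fun_eq_iff seq_scale_def algebra_simps)
      then have "seq_scale k0 h - seq_scale k h0 \<in> int_seq.span B"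
        using k k0 by (simp add: int_seq.span_diff int_seq.span_scale)
      then have "seq_scale k0 h - seq_scale k h0 = 0"
        by (rule F(2)) (use h(2) h0(2) in \<open>auto simp: seq_scale_def\<close>)
      then have "k0 * h n0 - k * h0 n0 = 0"
        by (simp add: fun_eq_iff seq_scale_def)
      with h h0(3) have "k = 0" by simp
      with k have "h \<in> int_seq.span B" by (simp add: seq_scale_def zero_fun_def[symmetric])
      then show ?thesis by (rule F(2)) (use h(2) in auto)
    qed
    with F(1) show ?thesis by (intro exI[of _ "insert n0 F"]) blast
  qed
qed

text \<open>Values on a finite separating set determine an element of the span, and bounded integers
  leave finitely many choices there.\<close>

lemma finite_bounded_span:
  assumes "finite B"
  shows "finite {g \<in> int_seq.span B. \<forall>n. \<bar>g n\<bar> \<le> C}" (is "finite ?A")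
proof -
  obtain F where F: "finite F"
    "\<And>g. g \<in> int_seq.span B \<Longrightarrow> (\<forall>n\<in>F. g n = 0) \<Longrightarrow> g = 0"
    using finite_separating_set[OF assms] by blast
  have "inj_on (\<lambda>g. restrict g F) ?A"
  proof (rule inj_onI)
    fix g h assume g: "g \<in> ?A" and h: "h \<in> ?A" and eq: "restrict g F = restrict h F"
    have "g n = h n" if "n \<in> F" for n using eq that by (metis restrict_apply')
    then have "g - h = 0"
      by (intro F(2)) (use g h in \<open>auto intro: int_seq.span_diff\<close>)
    then show "g = h" by simp
  qed
  moreover have "(\<lambda>g. restrict g F) ` ?A \<subseteq> (\<Pi>\<^sub>E n\<in>F. {-C..C})"
    by (auto simp: abs_le_iff minus_le_iff)
  then have "finite ((\<lambda>g. restrict g F) ` ?A)"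
    by (rule finite_subset) (simp add: finite_PiE F(1))
  ultimately show ?thesis by (rule finite_imageD[rotated])
qed

lemma q_regular_imp_equal_gaps:
  assumes "q \<ge> 2" "q_regular q (\<lambda>n. int (a_seq n))"
  obtains i i' where "3 \<le> i" "i < i'"
    "\<And>n. a_seq (q ^ i * n + 1) - a_seq (q ^ i * n) = a_seq (q ^ i' * n + 1) - a_seq (q ^ i' * n)"
proof -
  let ?x = "\<lambda>n. int (a_seq n)"
  obtain B where B: "finite B" "int_seq.span B = int_seq.span (q_kernel q ?x)"
    using assms(2) by (auto simp: q_regular_def)
  define D where "D i n = ?x (q ^ i * n + 1) - ?x (q ^ i * n)" for i n
  have D_eq: "D i n = int (a_seq (q ^ i * n + 1) - a_seq (q ^ i * n))" for i n
    using a_seq_less_Suc[of "q ^ i * n"] by (simp add: D_def of_nat_diff)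
  \<comment> \<open>Starting at \<open>3\<close> makes \<open>1\<close> an admissible offset in the
    kernel and later ensures \<open>2 \<le> I\<close> for powers of two.\<close>
  have "D i \<in> int_seq.span B" if "i \<ge> 3" for i
  proof -
    have "q ^ 1 \<le> q ^ i" using that assms(1) by (intro power_increasing) auto
    then have "1 \<le> q ^ i - 1" using assms(1) by simp
    then have "(\<lambda>n. ?x (q ^ i * n + 1)) \<in> q_kernel q ?x" "(\<lambda>n. ?x (q ^ i * n + 0)) \<in> q_kernel q ?x"
      unfolding q_kernel_def by blast+
    then have "(\<lambda>n. ?x (q ^ i * n + 1)) - (\<lambda>n. ?x (q ^ i * n + 0)) \<in> int_seq.span B"
      unfolding B(2) by (intro int_seq.span_diff int_seq.span_base)
    moreover have "D i = (\<lambda>n. ?x (q ^ i * n + 1)) - (\<lambda>n. ?x (q ^ i * n + 0))"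
      by (simp add: D_def fun_eq_iff)
    ultimately show ?thesis by simp
  qed
  moreover have "\<bar>D i n\<bar> \<le> 4" for i n
    using a_seq_less_Suc[of "q ^ i * n"] a_seq_Suc_le[of "q ^ i * n"] by (simp add: D_def)
  ultimately have "D ` {3..} \<subseteq> {g \<in> int_seq.span B. \<forall>n. \<bar>g n\<bar> \<le> 4}" by auto
  then have "finite (D ` {3..})" by (rule finite_subset) (rule finite_bounded_span[OF B(1)])
  then have "\<not> inj_on D {3..}" using finite_imageD infinite_Ici by blast
  then obtain i j where "i \<ge> 3" "j \<ge> 3" "i \<noteq> j" "D i = D j" by (auto simp: inj_on_def)
  then have "\<exists>i i'. 3 \<le> i \<and> i < i' \<and> D i = D i'" by (metis linorder_neqE_nat)
  then obtain i i' where "3 \<le> i" "i < i'" "D i = D i'" by blast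
  then show ?thesis
    using that[of i i'] D_eq by (metis of_nat_eq_iff)
qed

section \<open>Powers of two\<close>

lemma gaps_differ_power_2:
  assumes "2 \<le> I" "I < J"
  shows "\<exists>n. a_seq (2 ^ I * n + 1) - a_seq (2 ^ I * n) \<noteq> a_seq (2 ^ J * n + 1) - a_seq (2 ^ J * n)"
proof -
  \<comment> \<open>This value of \<open>pf_sum x\<close> puts the term of index
    \<open>2 ^ I * n\<close> at \<open>2 ^ I * x\<close>, at distance \<open>2 ^ I\<close> below
    \<open>2 ^ (I + 1) * n\<close>.\<close>
  obtain x where x: "x mod 4 = 1" "pf_sum x = 2 * int (2 ^ (I - 1) - 1) + 1"
    using ex_pf_sum_eq by blast
  have "(2::int) ^ I = 2 * 2 ^ (I - 1)" using assms(1) by (cases I) auto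
  moreover have "int (2 ^ (I - 1) - 1) = 2 ^ (I - 1) - 1" by (simp add: of_nat_diff)
  ultimately have pfx: "pf_sum x = 2 ^ I - 1" using x(2) by simp
  define n where "n = (x + 1) div 2"
  have xn: "x = 2 * n - 1" and "n > 0" and n: "odd n" using x(1) unfolding n_def by presburger+
  define t :: nat where "t = 2 ^ I - 1"
  have t: "pf t = -1" "pf_sum t = 1" "t < 2 ^ I" "int t = 2 ^ I - 1"
    using assms pf_pred_power_2[of I] pf_sum_pred_power_2[of I] by (auto simp: t_def of_nat_diff)
  have upper: "a_seq (2 ^ H * n + 1) = 2 ^ (H + 1) * n - t" "t < 2 ^ H" if "H \<ge> I" for H
  proof -
    have "(2::nat) ^ I \<le> 2 ^ H" using that by (intro power_increasing) auto
    then show tH: "t < 2 ^ H" using t(3) by linarith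
    moreover have "2 ^ H \<le> 2 ^ (H + 1) * n" using \<open>n > 0\<close> by simp
    ultimately have "2 ^ (H + 1) * n - t + t = 2 ^ (H + 1) * n" by linarith
    then show "a_seq (2 ^ H * n + 1) = 2 ^ (H + 1) * n - t"
      by (intro a_seq_reflect[of t H _ n])
        (use t tH pfx[unfolded xn] in simp_all)
  qed
  have "a_seq (2 ^ I * n) = 2 ^ I * x"
  proof (rule a_seq_eqI)
    show "pf (2 ^ I * x) = 1" using x(1) by (simp add: pf_4k1)
    have I1: "Suc (I - 1) = I" using assms by simp
    have "pf_sum (2 ^ I * x) = pf_sum (2 * x)"
      using pf_sum_power_2_times[of "I - 1" x] unfolding I1 .
    also have "\<dots> = pf_sum x + 1" using x(1) by (subst pf_sum_double) (simp, presburger)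
    finally have "pf_sum (2 ^ I * x) = 2 ^ I" using pfx by simp
    then have "int (2 ^ I * x) + pf_sum (2 ^ I * x) = 2 ^ I * (int x + 1)"
      by (simp add: distrib_left)
    also have "int x + 1 = 2 * int n" using xn \<open>n > 0\<close> by (simp add: of_nat_diff)
    finally show "int (2 ^ I * x) + pf_sum (2 ^ I * x) = 2 * int (2 ^ I * n)" by simp
  qed
  moreover have "2 ^ (I + 1) * n = 2 ^ I * x + 2 ^ I"
  proof -
    have "2 ^ (I + 1) * n = 2 ^ I * (2 * n)" by simp
    also have "2 * n = x + 1" using xn \<open>n > 0\<close> by simp
    finally show ?thesis by simp
  qed
  moreover have "t + 1 = 2 ^ I" by (simp add: t_def)
  ultimately have I_gap: "a_seq (2 ^ I * n + 1) - a_seq (2 ^ I * n) = 1"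
    using upper(1)[of I] by linarith
  \<comment> \<open>For \<open>J\<close> the reflection rule still covers distance
    \<open>2 ^ I\<close>, and \<open>pf (2 ^ I) = 1\<close> means that the mirror image is not a
    term.\<close>
  have "a_seq (2 ^ J * n + 1) - a_seq (2 ^ J * n) \<noteq> 1"
  proof
    assume "a_seq (2 ^ J * n + 1) - a_seq (2 ^ J * n) = 1"
    then have "a_seq (2 ^ J * n) + 1 = 2 ^ (J + 1) * n - t"
      using upper(1)[of J] assms(2) by linarith
    moreover have "t + 1 = 2 ^ I" by (simp add: t_def)
    ultimately have "a_seq (2 ^ J * n) + 2 ^ I = 2 ^ (J + 1) * n" by linarith
    then have "pf (a_seq (2 ^ J * n)) = - pf (2 ^ I)"
      using assms(2) by (intro pf_reflect[of "2 ^ I" J _ n]) auto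
    moreover have "pf (2 ^ I) = 1" using pf_power_2_times[of I 1] pf_4k1[of 1] by simp
    moreover have "pf (a_seq (2 ^ J * n)) = 1" using \<open>n > 0\<close> by (intro pf_a_seq) simp
    ultimately show False by simp
  qed
  with I_gap show ?thesis by metis
qed

section \<open>Bases with a nontrivial odd part\<close>

primrec repeat_block :: "nat \<Rightarrow> nat \<Rightarrow> nat \<Rightarrow> nat" where
  "repeat_block K w 0 = 0"
| "repeat_block K w (Suc s) = 2 ^ K * repeat_block K w s + w"

lemma repeat_block_mult: "c * repeat_block K w s = repeat_block K (c * w) s"
  by (induction s) (simp_all add: algebra_simps)

lemma repeat_block_ones: "repeat_block K (2 ^ K - 1) s = 2 ^ (K * s) - 1"
proof (induction s)
  case (Suc s)
  have "(1::nat) \<le> 2 ^ (K * s)" "(1::nat) \<le> 2 ^ K" by simp_all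
  moreover have "2 ^ K * 2 ^ (K * s) \<ge> (2::nat) ^ K" by simp
  ultimately show ?case
    by (simp add: Suc.IH power_add diff_mult_distrib2 del: One_nat_def)
qed simp

text \<open>The bound leaves a leading zero bit in each block, so the shift rule splits off one
  block at a time.\<close>

lemma pf_sum_repeat_block:
  assumes "2 * w < 2 ^ K"
  shows "pf_sum (2 * repeat_block K w s) = int s * pf_sum (2 * w)"
proof (induction s)
  case (Suc s)
  have "2 * repeat_block K w (Suc s) = 2 ^ (K + 1) * repeat_block K w s + 2 * w"
    by (simp add: algebra_simps)
  then have "pf_sum (2 * repeat_block K w (Suc s)) =
      pf_sum (2 * repeat_block K w s) + pf_sum (2 * w)"
    using pf_sum_shift[OF assms] by metis
  then show ?case using Suc.IH by (simp add: algebra_simps)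
qed simp

lemma pf_repeat_block:
  assumes "0 < w" "2 * w < 2 ^ K" "s > 0"
  shows "pf (repeat_block K w s) = pf w"
proof -
  obtain r where r: "s = Suc r" using assms(3) gr0_implies_Suc by blast
  obtain L where L: "K = Suc L" using assms(1,2) by (cases K) auto
  show ?thesis using pf_shift[of w L] assms r L by simp
qed

lemma odd_dvd_pred_power_2:
  assumes "odd (y::nat)"
  obtains A where "A \<ge> 2" "y dvd 2 ^ A - 1"
proof -
  have "[2 ^ totient y = 1] (mod y)" using assms by (intro euler_theorem) simp
  \<comment> \<open>Squaring makes the exponent at least \<open>2\<close>, even for
    \<open>y = 1\<close>.\<close>
  then have "[(2 ^ totient y) ^ 2 = 1 ^ 2] (mod y)" by (rule cong_pow)
  then have "[2 ^ (totient y * 2) = 1] (mod y)" by (simp add: power_mult)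
  then have "y dvd 2 ^ (totient y * 2) - 1"
    by (rule cong_to_1_nat)
  moreover have "totient y * 2 \<ge> 2" using assms by (simp add: Suc_leI odd_pos)
  ultimately show ?thesis using that by blast
qed

lemma odd_decompose:
  assumes "(y::nat) > 0"
  obtains b r where "y = 2 ^ b * r" "odd r"
proof -
  have "y \<noteq> 0" using assms by simp
  then obtain r where "y = 2 ^ multiplicity 2 y * r" "odd r"
    using multiplicity_decompose'[of y 2] by (metis not_prime_unit two_is_prime_nat)
  then show ?thesis using that by blast
qed

lemma ex_multiple_pf_sum:
  assumes "y > 0"
  obtains Y where "y dvd Y" "pf_sum (2 * Y) = 2 * int k"
proof -
  obtain b r where y: "y = 2 ^ b * r" "odd r" using odd_decompose[OF assms] .
  obtain A where A: "A \<ge> 2" "r dvd 2 ^ A - 1" using odd_dvd_pred_power_2[OF y(2)] .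
  \<comment> \<open>Each block of ones adds \<open>2\<close> to the sum, the width
    \<open>2 * A\<close> leaves room for the shift rule, and the common factor
    \<open>2 ^ A - 1\<close> gives divisibility by \<open>r\<close>.\<close>
  define Z where "Z = repeat_block (2 * A) (2 ^ A - 1) k"
  have "Z = (2 ^ A - 1) * repeat_block (2 * A) 1 k" by (simp add: Z_def repeat_block_mult)
  with A(2) have "y dvd 2 ^ b * Z" by (simp add: y(1))
  moreover have "pf_sum (2 * (2 ^ b * Z)) = 2 * int k"
  proof -
    have "(2::nat) * 2 ^ A \<le> 2 ^ A * 2 ^ A"
      using A(1) self_le_power[of "2::nat" A] by (intro mult_right_mono) auto
    then have "2 * (2 ^ A - 1) < (2::nat) ^ (2 * A)"
      by (simp add: mult_2 power_add) (use zero_less_power[of "2::nat" A] in linarith)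
    then have "pf_sum (2 * Z) = 2 * int k"
      unfolding Z_def using A(1) by (subst pf_sum_repeat_block) (simp_all add: pf_sum_double_pred_power_2 del: One_nat_def)
    moreover have "2 * (2 ^ b * Z) = 2 ^ Suc b * Z" by simp
    ultimately show ?thesis using pf_sum_power_2_times[of b Z] by metis
  qed
  ultimately show ?thesis using that by blast
qed

text \<open>
  In the proof, \<open>y\<close> is the step of the arithmetic progression described above. The repetition
  count \<open>s\<close> is chosen with \<open>y * s = 8 * Y\<close>, where \<open>pf_sum (2 * Y)\<close> is such that the gap for
  \<open>i\<close> is the one between \<open>16 * Y + 6\<close> and \<open>16 * Y + 7\<close>, a translate of the gap between \<open>6\<close> and
  \<open>7\<close>. The gap for \<open>j\<close> is the one between \<open>3\<close> and \<open>6\<close>.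
\<close>

lemma gaps_differ_odd_part:
  assumes "odd p" "p \<ge> 3" "i < j"
  shows "\<exists>n. a_seq ((2 ^ k * p) ^ i * n + 1) - a_seq ((2 ^ k * p) ^ i * n) \<noteq>
    a_seq ((2 ^ k * p) ^ j * n + 1) - a_seq ((2 ^ k * p) ^ j * n)"
proof -
  have "odd (p ^ j)" using assms(1) by simp
  then obtain K where K: "K \<ge> 2" "p ^ j dvd 2 ^ K - 1" by (rule odd_dvd_pred_power_2)
  from K(2) obtain v where v: "p ^ j * v = 2 ^ K - 1" by (metis dvdE)
  define w where "w = p ^ i * v"
  have K4: "(2::nat) ^ K \<ge> 4" using K(1) power_increasing[of 2 K "2::nat"] by simp
  have "v > 0" using v K4 by (cases v) auto
  then have w: "w > 0" using assms(2) by (simp add: w_def)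
  have "p ^ (j - i) * w = 2 ^ K - 1"
    using v assms(3) by (simp add: w_def mult.assoc[symmetric] power_add[symmetric])
  moreover have "3 \<le> p ^ (j - i)"
    using assms(2,3) self_le_power[of p "j - i"] by simp
  then have "3 * w \<le> p ^ (j - i) * w" by simp
  ultimately have w2: "2 * w < 2 ^ K" using w by linarith
  have "even (pf_sum (2 * w))" by (simp add: even_pf_sum_iff)
  moreover have "pf_sum (2 * w) > 0" using w by (intro pf_sum_pos) simp
  ultimately obtain y where y: "y > 0" "pf_sum (2 * w) = 2 * int y"
    by (metis evenE zero_less_mult_pos zero_less_numeral pos_int_cases)
  obtain d :: nat where d: "pf w = 2 * int d - 1"
    using pf_cases[OF w] that[of 0] that[of 1] by auto
  \<comment> \<open>The target \<open>2 + d\<close> yields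
    \<open>pf_sum (2 * M - 1) + 1 = int t - pf_sum t\<close> below for
    \<open>t = 16 * Y + 7\<close>; \<open>d\<close> absorbs the sign of \<open>pf w\<close>.\<close>
  obtain Y where Y: "y dvd Y" "pf_sum (2 * Y) = 2 * int (2 + d)"
    using ex_multiple_pf_sum[OF y(1)] .
  from Y(1) obtain s0 where s0: "Y = y * s0" by blast
  have "Y > 0" using Y(2) by (cases Y) auto
  define s where "s = 8 * s0"
  have s: "s > 0" using \<open>Y > 0\<close> s0 by (simp add: s_def)
  define t where "t = 16 * Y + 7"
  \<comment> \<open>The factor \<open>2 ^ t\<close> keeps all distances used below
    \<open>2 ^ L\<close> for both exponents.\<close>
  define n where "n = 2 ^ t * repeat_block K v s"
  have t_less: "t < 2 ^ (c + t)" for c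
    using less_exp[of t] power_increasing[of t "c + t" "2::nat"] by linarith
  have shift: "pf (16 * Y + m) = pf m" "pf_sum (16 * Y + m) = 2 * int (2 + d) + pf_sum m"
    if "0 < m" "m < 8" for m
    using pf_shift[of m 3 Y] pf_sum_shift[of m 3 Y] that Y(2) by simp_all

  have i_gap: "a_seq ((2 ^ k * p) ^ i * n + 1) - a_seq ((2 ^ k * p) ^ i * n) = 1"
  proof -
    define M where "M = repeat_block K w s"
    define L where "L = k * i + t"
    have "M = p ^ i * repeat_block K v s"
      by (simp add: M_def w_def repeat_block_mult)
    then have N: "(2 ^ k * p) ^ i * n = 2 ^ L * M"
      by (simp add: n_def L_def power_mult_distrib power_add power_mult[symmetric] mult_ac)
    have "M > 0" unfolding M_def using s w by (cases s) auto
    have "pf_sum (2 * M) = pf_sum (2 * M - 1) + pf (2 * M)"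
      using pf_sum_Suc[of "2 * M - 1"] \<open>M > 0\<close> by simp
    then have c: "pf_sum (2 * M - 1) = 16 * int Y - 2 * int d + 1"
      using pf_sum_repeat_block[OF w2, of s] pf_repeat_block[OF w w2 s] d y(2) s0
      by (simp add: M_def s_def algebra_simps)
    have tL: "t < 2 ^ L" unfolding L_def by (rule t_less)
    have "2 ^ L \<le> 2 ^ (L + 1) * M" using \<open>M > 0\<close> by simp
    with tL have le: "t \<le> 2 ^ (L + 1) * M" by linarith
    have "a_seq (2 ^ L * M) = 2 ^ (L + 1) * M - t"
      by (rule a_seq_reflect[of t L _ M])
        (use tL le c shift[of 7] in \<open>simp_all add: t_def pf_small pf_sum_small\<close>)
    moreover have "a_seq (2 ^ L * M + 1) = 2 ^ (L + 1) * M - (16 * Y + 6)"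
      by (rule a_seq_reflect[of "16 * Y + 6" L _ M])
        (use tL le c shift[of 6] in \<open>simp_all add: t_def pf_small pf_sum_small\<close>)
    ultimately show ?thesis unfolding N using le by (simp add: t_def)
  qed

  have j_gap: "a_seq ((2 ^ k * p) ^ j * n + 1) - a_seq ((2 ^ k * p) ^ j * n) = 3"
  proof -
    define M :: nat where "M = 2 ^ (K * s) - 1"
    define L where "L = k * j + t"
    have "M = p ^ j * repeat_block K v s"
      by (simp add: M_def repeat_block_mult v repeat_block_ones del: One_nat_def)
    then have N: "(2 ^ k * p) ^ j * n = 2 ^ L * M"
      by (simp add: n_def L_def power_mult_distrib power_add power_mult[symmetric] mult_ac)
    have "K * 1 \<le> K * s" using s by (intro mult_le_mono2) simp
    with K(1) have Ks: "K * s \<ge> 2" by linarith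
    have "(2::nat) ^ (K * s) \<ge> 2 ^ 2" using Ks by (intro power_increasing) auto
    then have "M > 0" by (simp add: M_def)
    have "pf_sum (2 * M) = pf_sum (2 * M - 1) + pf (2 * M)"
      using pf_sum_Suc[of "2 * M - 1"] \<open>M > 0\<close> by simp
    moreover have "pf_sum (2 * M) = 2"
      unfolding M_def using Ks by (intro pf_sum_double_pred_power_2) linarith
    moreover have "pf M = -1" unfolding M_def by (rule pf_pred_power_2[OF Ks])
    ultimately have c: "pf_sum (2 * M - 1) = 3" by simp
    have tL: "t < 2 ^ L" unfolding L_def by (rule t_less)
    have "2 ^ L \<le> 2 ^ (L + 1) * M" using \<open>M > 0\<close> by simp
    with tL have le: "t \<le> 2 ^ (L + 1) * M" by linarith
    \<comment> \<open>The first two positions with \<open>pf = -1\<close> are \<open>3\<close> and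
      \<open>6\<close>; \<open>c\<close> makes the term of index \<open>2 ^ L * M\<close> the mirror
      image of the second.\<close>
    have small: "6 < t" by (simp add: t_def)
    have "a_seq (2 ^ L * M) = 2 ^ (L + 1) * M - 6"
    proof (rule a_seq_reflect)
      show "6 < (2::nat) ^ L" using tL small by linarith
      show "2 ^ (L + 1) * M - 6 + 6 = 2 ^ (L + 1) * M" using le small by linarith
    qed (use c in \<open>simp_all add: pf_small pf_sum_small\<close>)
    moreover have "a_seq (2 ^ L * M + 1) = 2 ^ (L + 1) * M - 3"
    proof (rule a_seq_reflect)
      show "3 < (2::nat) ^ L" using tL small by linarith
      show "2 ^ (L + 1) * M - 3 + 3 = 2 ^ (L + 1) * M" using le small by linarith
    qed (use c in \<open>simp_all add: pf_small pf_sum_small\<close>)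
    moreover have "x - 3 - (x - 6) = 3" if "6 \<le> x" for x :: nat using that by simp
    moreover have "6 \<le> 2 ^ (L + 1) * M" using le small by linarith
    ultimately show ?thesis unfolding N by metis
  qed
  have "(1::nat) \<noteq> 3" by simp
  with i_gap j_gap show ?thesis by metis
qed

theorem theorem9:
  fixes q :: nat
  assumes "q \<ge> 2"
  shows "\<not> q_regular q (\<lambda>n. int (a_seq n))"
proof
  assume "q_regular q (\<lambda>n. int (a_seq n))"
  with assms obtain i j where ij: "3 \<le> i" "i < j" and eq:
    "\<And>n. a_seq (q ^ i * n + 1) - a_seq (q ^ i * n) = a_seq (q ^ j * n + 1) - a_seq (q ^ j * n)"
    by (rule q_regular_imp_equal_gaps) blast
  obtain k p where q: "q = 2 ^ k * p" "odd p" using odd_decompose[of q] assms by auto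
  show False
  proof (cases "p = 1")
    case True
    with q assms have k: "k > 0" by (cases k) auto
    then have "1 * 3 \<le> k * i" using ij(1) by (intro mult_le_mono) auto
    then show ?thesis
      using gaps_differ_power_2[of "k * i" "k * j"] eq True k ij(2) by (auto simp: q(1) power_mult)
  next
    case False
    with q(2) have "p \<ge> 3" by presburger
    then show ?thesis using gaps_differ_odd_part[OF q(2) _ ij(2), of k] eq by (auto simp: q(1))
  qed
qed

end
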